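(* Let $\Omega$ be an arbitrary non-empty set, $\mathcal{E} \subseteq \mathcal{P}(\Omega)$ an arbitrary non-empty family of events, and $Bel:\mathcal{E} \to [0,1]$ a belief assessment (i.e. an arbitrary function). Then the following statements are equivalent: (i) $Bel$ is coherent-1; (ii) $Bel$ is coherent-2; (iii) $Bel$ is coherent-3; (iv) $Bel$ is coherent-4; (v) $Bel$ is coherent-5.
   Context: $\mathcal{P}(\Omega)$ is the power set of $\Omega$; $\mathbf{1}_A:\Omega\to\{0,1\}$ is the indicator of $A$. For a non-empty family $\mathcal{G}\subseteq\mathcal{P}(\Omega)$, $\mathcal{A}_{\mathcal{G}}$ denotes the minimal algebra of subsets of $\Omega$ containing $\mathcal{G}$, and $\mathcal{U}_{\mathcal{G}} = \mathcal{A}_{\mathcal{G}}\setminus\{\emptyset\}$. For $A\in\mathcal{A}_{\mathcal{G}}$ let $\tilde{A} = \{B\in\mathcal{U}_{\mathcal{G}} : B\subseteq A\}\subseteq \mathcal{U}_{\mathcal{G}}$, and let $\mathfrak{A}_{\mathcal{G}}$ be the minimal algebra of subsets of $\mathcal{U}_{\mathcal{G}}$ containing $\{\tilde{A} : A\in\mathcal{U}_{\mathcal{G}}\}$. For $B\neq\emptyset$ and an event $E$, $\min_{\omega\in B}\mathbf{1}_E(\omega)$ equals $1$ if $B\subseteq E$ and $0$ otherwise. A belief function on an algebra $\mathcal{A}\subseteq\mathcal{P}(\Omega)$ is a map $\beta:\mathcal{A}\to[0,1]$ with $\beta(\emptyset)=0$, $\beta(\Omega)=1$ and, for every $k\ge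 2$ and $A_1,\dots,A_k\in\mathcal{A}$, $$\beta\Big(\bigcup_{i=1}^k A_i\Big)\ \ge \sum_{\emptyset\ne I\subseteq\{1,\dots,k\}} (-1)^{|I|+1}\beta\Big(\bigcap_{i\in I}A_i\Big).$$ A belief assessment $Bel:\mathcal{E}\to[0,1]$ is called: - coherent-1 if there is a belief function $Bel':\mathcal{A}_{\mathcal{E}}\to[0,1]$ with $Bel(E)=Bel'(E)$ for every $E\in\mathcal{E}$; - coherent-2 if there is a finitely additive probability $\mu:\mathfrak{A}_{\mathcal{E}}\to[0,1]$ such that, for every $E\in\mathcal{E}$, $Bel(E)=\int_{\mathcal{U}_{\mathcal{E}}}\big(\min_{\omega\in B}\mathbf{1}_E(\omega)\big)\,\mu(\mathrm{d}B)$ (Stieltjes-type integral with respect to a finitely additive measure); - coherent-3 if, for every $n\in\mathbb{N}$ and every $\mathcal{F}=\{E_1,\dots,E_n\}\subseteq\mathcal{E}$, the following linear system in the unknowns $x_B$, $B\in\mathcal{U}_{\mathcal{F}}$, has a solution: $\sum_{B\in\mathcal{U}_{\mathcal{F}}}\big(\min_{\omega\in B}\mathbf{1}_{E_i}(\omega)\big)x_B = Bel(E_i)$ for $i=1,\dots,n$; $\sum_{B\in\mathcal{U}_{\mathcal{F}}}x_B=1$; $x_B\ge 0$ for every $B\in\mathcal{U}_{\mathcal{F}}$; - coherent-4 if, for every $n\in\mathbb{N}$, every $\mathcal{F}=\{E_1,\dots,E_n\}\subseteq\mathcal{E}$ and every $\lambda_1,\dots,\lambda_n\in\mathbb{R}$,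 the function $G_{\mathcal{F}}:\mathcal{U}_{\mathcal{F}}\to\mathbb{R}$, $G_{\mathcal{F}}(B)=\sum_{i=1}^n\lambda_i\big(\min_{\omega\in B}\mathbf{1}_{E_i}(\omega)-Bel(E_i)\big)$, satisfies $\max_{B\in\mathcal{U}_{\mathcal{F}}}G_{\mathcal{F}}(B)\ge 0$; - coherent-5 if, for every $n\in\mathbb{N}$ and every $\mathcal{F}=\{E_1,\dots,E_n\}\subseteq\mathcal{E}$, there is no assessment $Bel^*:\mathcal{F}\to[0,1]$ distinct from the restriction of $Bel$ to $\mathcal{F}$ such that the functions $L^*_{\mathcal{F}},L_{\mathcal{F}}:\mathcal{U}_{\mathcal{F}}\to\mathbb{R}$, $L^*_{\mathcal{F}}(B)=\sum_{i=1}^n\big(\min_{\omega\in B}\mathbf{1}_{E_i}(\omega)-Bel^*(E_i)\big)^2$ and $L_{\mathcal{F}}(B)=\sum_{i=1}^n\big(\min_{\omega\in B}\mathbf{1}_{E_i}(\omega)-Bel(E_i)\big)^2$, satisfy $L^*_{\mathcal{F}}(B)<L_{\mathcal{F}}(B)$ for every $B\in\mathcal{U}_{\mathcal{F}}$. *)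

theory Defs
  imports "HOL-Analysis.Analysis"
begin

text \<open>
  Events are subsets of a fixed set \<open>\<Omega>\<close>. Assessments and set functions are total functions whose
  values outside the family under consideration are irrelevant.
\<close>

definition gen_algebra :: "'a set \<Rightarrow> 'a set set \<Rightarrow> 'a set set" where
  "gen_algebra \<Omega> G = algebra \<Omega> hull G"

definition nonempty_events :: "'a set \<Rightarrow> 'a set set \<Rightarrow> 'a set set" where
  "nonempty_events \<Omega> G = gen_algebra \<Omega> G - {{}}"

definition tilde :: "'a set \<Rightarrow> 'a set set \<Rightarrow> 'a set \<Rightarrow> 'a set set" where
  "tilde \<Omega> G A = {B \<in> nonempty_events \<Omega> G. B \<subseteq> A}"

definition tilde_algebra :: "'a set \<Rightarrow> 'a set set \<Rightarrow> 'a set set set" where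
  "tilde_algebra \<Omega> G =
     gen_algebra (nonempty_events \<Omega> G) (tilde \<Omega> G ` nonempty_events \<Omega> G)"

text \<open>
  The set \<open>B\<close> may be infinite, but the image of \<open>B\<close> under an indicator is finite, so \<^const>\<open>Min\<close> is
  meaningful for \<open>B \<noteq> {}\<close>; see \<open>min_indicator_eq\<close> below.
\<close>

definition min_indicator :: "'a set \<Rightarrow> 'a set \<Rightarrow> real" where
  "min_indicator E B = (MIN \<omega>\<in>B. indicator E \<omega>)"

definition belief_function :: "'a set \<Rightarrow> 'a set set \<Rightarrow> ('a set \<Rightarrow> real) \<Rightarrow> bool" where
  "belief_function \<Omega> M \<beta> \<longleftrightarrow>
     \<beta> \<in> M \<rightarrow> {0..1} \<and> \<beta> {} = 0 \<and> \<beta> \<Omega> = 1 \<and>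
     (\<forall>k\<ge>2. \<forall>A :: nat \<Rightarrow> 'a set. A \<in> {1..k} \<rightarrow> M \<longrightarrow>
        \<beta> (\<Union>i\<in>{1..k}. A i) \<ge>
          (\<Sum>I\<in>Pow {1..k} - {{}}. (- 1) ^ (card I + 1) * \<beta> (\<Inter>i\<in>I. A i)))"

definition fin_additive_prob :: "'b set \<Rightarrow> 'b set set \<Rightarrow> ('b set \<Rightarrow> real) \<Rightarrow> bool" where
  "fin_additive_prob X M \<mu> \<longleftrightarrow> \<mu> \<in> M \<rightarrow> {0..1} \<and> \<mu> X = 1 \<and> additive M \<mu>"

text \<open>
  The Stieltjes-type integral of a bounded function with respect to a finitely additive measure on
  an algebra \<open>M\<close> of subsets of \<open>X\<close>: the common value of the lower and upper integrals, obtained from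
  the Darboux sums over finite partitions of \<open>X\<close> into members of \<open>M\<close>.
\<close>

definition finite_partitions :: "'b set \<Rightarrow> 'b set set \<Rightarrow> 'b set set set" where
  "finite_partitions X M = {P. finite P \<and> P \<subseteq> M \<and> partition_on X P}"

definition lower_stieltjes ::
    "'b set \<Rightarrow> 'b set set \<Rightarrow> ('b set \<Rightarrow> real) \<Rightarrow> ('b \<Rightarrow> real) \<Rightarrow> real" where
  "lower_stieltjes X M \<mu> f = (SUP P\<in>finite_partitions X M. \<Sum>A\<in>P. (INF x\<in>A. f x) * \<mu> A)"

definition upper_stieltjes ::
    "'b set \<Rightarrow> 'b set set \<Rightarrow> ('b set \<Rightarrow> real) \<Rightarrow> ('b \<Rightarrow> real) \<Rightarrow> real" where
  "upper_stieltjes X M \<mu> f = (INF P\<in>finite_partitions X M. \<Sum>A\<in>P. (SUP x\<in>A. f x) * \<mu> A)"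

definition has_stieltjes_integral ::
    "'b set \<Rightarrow> 'b set set \<Rightarrow> ('b set \<Rightarrow> real) \<Rightarrow> ('b \<Rightarrow> real) \<Rightarrow> real \<Rightarrow> bool" where
  "has_stieltjes_integral X M \<mu> f I \<longleftrightarrow>
     bounded (f ` X) \<and> lower_stieltjes X M \<mu> f = I \<and> upper_stieltjes X M \<mu> f = I"

definition coherent1 :: "'a set \<Rightarrow> 'a set set \<Rightarrow> ('a set \<Rightarrow> real) \<Rightarrow> bool" where
  "coherent1 \<Omega> \<E> Bel \<longleftrightarrow>
     (\<exists>Bel'. belief_function \<Omega> (gen_algebra \<Omega> \<E>) Bel' \<and> (\<forall>E\<in>\<E>. Bel E = Bel' E))"

definition coherent2 :: "'a set \<Rightarrow> 'a set set \<Rightarrow> ('a set \<Rightarrow> real) \<Rightarrow> bool" where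
  "coherent2 \<Omega> \<E> Bel \<longleftrightarrow>
     (\<exists>\<mu>. fin_additive_prob (nonempty_events \<Omega> \<E>) (tilde_algebra \<Omega> \<E>) \<mu> \<and>
        (\<forall>E\<in>\<E>. has_stieltjes_integral (nonempty_events \<Omega> \<E>) (tilde_algebra \<Omega> \<E>) \<mu>
           (\<lambda>B. min_indicator E B) (Bel E)))"

text \<open>
  In the remaining conditions the finite family \<open>\<F> = {E\<^sub>1, \<dots>, E\<^sub>n}\<close> is a finite non-empty subset of
  \<open>\<E>\<close>, and its members serve as indices. The set \<open>nonempty_events \<Omega> \<F>\<close> is then finite (lemma
  \<open>finite_nonempty_events\<close> below), so the sums and maxima over it are genuine.
\<close>

definition coherent3 :: "'a set \<Rightarrow> 'a set set \<Rightarrow> ('a set \<Rightarrow> real) \<Rightarrow> bool" where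
  "coherent3 \<Omega> \<E> Bel \<longleftrightarrow>
     (\<forall>\<F>. finite \<F> \<and> \<F> \<noteq> {} \<and> \<F> \<subseteq> \<E> \<longrightarrow>
        (\<exists>x :: 'a set \<Rightarrow> real.
           (\<forall>E\<in>\<F>. (\<Sum>B\<in>nonempty_events \<Omega> \<F>. min_indicator E B * x B) = Bel E) \<and>
           (\<Sum>B\<in>nonempty_events \<Omega> \<F>. x B) = 1 \<and>
           (\<forall>B\<in>nonempty_events \<Omega> \<F>. x B \<ge> 0)))"

definition gain ::
    "'a set set \<Rightarrow> ('a set \<Rightarrow> real) \<Rightarrow> ('a set \<Rightarrow> real) \<Rightarrow> 'a set \<Rightarrow> real" where
  "gain \<F> Bel lam B = (\<Sum>E\<in>\<F>. lam E * (min_indicator E B - Bel E))"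

definition coherent4 :: "'a set \<Rightarrow> 'a set set \<Rightarrow> ('a set \<Rightarrow> real) \<Rightarrow> bool" where
  "coherent4 \<Omega> \<E> Bel \<longleftrightarrow>
     (\<forall>\<F>. finite \<F> \<and> \<F> \<noteq> {} \<and> \<F> \<subseteq> \<E> \<longrightarrow>
        (\<forall>lam :: 'a set \<Rightarrow> real. (MAX B\<in>nonempty_events \<Omega> \<F>. gain \<F> Bel lam B) \<ge> 0))"

definition quadratic_loss :: "'a set set \<Rightarrow> ('a set \<Rightarrow> real) \<Rightarrow> 'a set \<Rightarrow> real" where
  "quadratic_loss \<F> Bel B = (\<Sum>E\<in>\<F>. (min_indicator E B - Bel E)\<^sup>2)"

definition coherent5 :: "'a set \<Rightarrow> 'a set set \<Rightarrow> ('a set \<Rightarrow> real) \<Rightarrow> bool" where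
  "coherent5 \<Omega> \<E> Bel \<longleftrightarrow>
     (\<forall>\<F>. finite \<F> \<and> \<F> \<noteq> {} \<and> \<F> \<subseteq> \<E> \<longrightarrow>
        \<not> (\<exists>Bel' \<in> \<F> \<rightarrow>\<^sub>E {0..1}. Bel' \<noteq> restrict Bel \<F> \<and>
             (\<forall>B\<in>nonempty_events \<Omega> \<F>. quadratic_loss \<F> Bel' B < quadratic_loss \<F> Bel B)))"

lemma algebra_gen_algebra:
  assumes "G \<subseteq> Pow \<Omega>"
  shows "algebra \<Omega> (gen_algebra \<Omega> G)"
proof -
  have Pow: "algebra \<Omega> (Pow \<Omega>)"
    by (auto simp: algebra_iff_Int)
  have "gen_algebra \<Omega> G \<subseteq> Pow \<Omega>"
    unfolding gen_algebra_def by (rule hull_minimal[where S = "algebra \<Omega>", OF assms Pow])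
  then show ?thesis
    by (auto simp: algebra_iff_Int gen_algebra_def hull_def)
qed

lemma min_indicator_eq:
  assumes "B \<noteq> {}"
  shows "min_indicator E B = of_bool (B \<subseteq> E)"
proof (cases "B \<subseteq> E")
  case True
  then have "(indicator E :: 'a \<Rightarrow> real) ` B = {1}"
    using assms by (force simp: indicator_def)
  with True show ?thesis
    by (simp add: min_indicator_def)
next
  case False
  have "finite ((indicator E :: 'a \<Rightarrow> real) ` B)"
    by (rule finite_subset[of _ "{0, 1}"]) (auto simp: indicator_def)
  moreover from False obtain w where "w \<in> B" "w \<notin> E"
    by blast
  then have "(0::real) \<in> indicator E ` B"
    by (intro image_eqI[of _ _ w]) auto
  ultimately have "Min ((indicator E :: 'a \<Rightarrow> real) ` B) = 0"
    by (intro Min_eqI) auto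
  with False show ?thesis
    by (simp add: min_indicator_def)
qed

lemma finite_nonempty_events:
  assumes "finite G" "G \<subseteq> Pow \<Omega>"
  shows "finite (nonempty_events \<Omega> G)"
proof -
  define f where "f = (\<lambda>S. {x \<in> \<Omega>. {E \<in> G. x \<in> E} \<in> S})"
  have "algebra \<Omega> (f ` Pow (Pow G))"
    unfolding algebra_iff_Int
  proof (intro conjI ballI)
    show "f ` Pow (Pow G) \<subseteq> Pow \<Omega>" by (auto simp: f_def)
    show "{} \<in> f ` Pow (Pow G)" by (rule image_eqI[of _ _ "{}"]) (auto simp: f_def)
  next
    fix a assume "a \<in> f ` Pow (Pow G)"
    then obtain S where "a = f S" "S \<subseteq> Pow G" by auto
    then show "\<Omega> - a \<in> f ` Pow (Pow G)"
      by (intro image_eqI[of _ _ "Pow G - S"]) (auto simp: f_def)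
  next
    fix a b assume "a \<in> f ` Pow (Pow G)" "b \<in> f ` Pow (Pow G)"
    then obtain S T where "a = f S" "S \<subseteq> Pow G" "b = f T" "T \<subseteq> Pow G" by auto
    then show "a \<inter> b \<in> f ` Pow (Pow G)"
      by (intro image_eqI[of _ _ "S \<inter> T"]) (auto simp: f_def)
  qed
  moreover have "G \<subseteq> f ` Pow (Pow G)"
  proof
    fix E assume "E \<in> G"
    then show "E \<in> f ` Pow (Pow G)"
      using assms(2) by (intro image_eqI[of _ _ "{H. H \<subseteq> G \<and> E \<in> H}"]) (auto simp: f_def)
  qed
  ultimately have "gen_algebra \<Omega> G \<subseteq> f ` Pow (Pow G)"
    unfolding gen_algebra_def by (rule hull_minimal[rotated])
  then show ?thesis
    unfolding nonempty_events_def using assms(1)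
    by (meson Diff_subset finite_Pow_iff finite_imageI finite_subset)
qed

end

theory Submission
  imports Defs
begin

text \<open>
  The integral of \<open>min_indicator E\<close> against \<open>\<mu>\<close> is \<open>\<mu> (tilde \<Omega> \<E> E)\<close>, so \<open>A \<mapsto> \<mu> (tilde \<Omega> \<E> A)\<close> is a
  belief function, by inclusion-exclusion and \<open>\<Union>i. tilde \<Omega> \<E> (A i) \<subseteq> tilde \<Omega> \<E> (\<Union>i. A i)\<close>.
  Conversely, the Moebius inverse of a belief function on the finite algebra generated by \<open>\<F>\<close> is
  non-negative and solves the linear system of coherent-3. The solutions for the finite subfamilies
  are finitely additive probabilities on all sets of events, and compactness of the product of unit
  intervals yields one that represents \<open>Bel\<close> on the whole of \<open>\<E>\<close>. Conditions 4 and 5 follow from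
  coherent-3 by averaging over a solution; if there is no solution, projecting \<open>Bel\<close> onto the
  convex hull of the vectors \<open>(min_indicator E B)\<^sub>E\<close> refutes both.
\<close>

subsection \<open>Generated algebras\<close>

lemma gen_algebra_subset: "G \<subseteq> gen_algebra \<Omega> G"
  unfolding gen_algebra_def by (rule hull_subset)

lemma gen_algebra_mono: "F \<subseteq> G \<Longrightarrow> gen_algebra \<Omega> F \<subseteq> gen_algebra \<Omega> G"
  unfolding gen_algebra_def by (rule hull_mono)

lemma nonempty_events_mono: "F \<subseteq> G \<Longrightarrow> nonempty_events \<Omega> F \<subseteq> nonempty_events \<Omega> G"
  unfolding nonempty_events_def using gen_algebra_mono by blast

lemma space_in_nonempty_events:
  assumes "G \<subseteq> Pow \<Omega>" "\<Omega> \<noteq> {}"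
  shows "\<Omega> \<in> nonempty_events \<Omega> G"
  using assms algebra.top[OF algebra_gen_algebra] by (auto simp: nonempty_events_def)

lemma min_indicator_nonempty_events:
  "B \<in> nonempty_events \<Omega> G \<Longrightarrow> min_indicator E B = of_bool (B \<subseteq> E)"
  by (rule min_indicator_eq) (auto simp: nonempty_events_def)

lemma algebra_tilde_algebra: "algebra (nonempty_events \<Omega> G) (tilde_algebra \<Omega> G)"
  unfolding tilde_algebra_def by (rule algebra_gen_algebra) (auto simp: tilde_def)

lemma tilde_empty: "tilde \<Omega> G {} = {}"
  by (auto simp: tilde_def nonempty_events_def)

lemma tilde_space:
  assumes "G \<subseteq> Pow \<Omega>"
  shows "tilde \<Omega> G \<Omega> = nonempty_events \<Omega> G"
  using algebra_gen_algebra[OF assms]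
  by (auto simp: tilde_def nonempty_events_def algebra_iff_Int)

text \<open>The generators of \<open>tilde_algebra\<close> are indexed by non-empty events only, so
  the empty event is handled apart: its \<open>tilde\<close> is \<open>{}\<close>, which lies in
  every algebra.\<close>

lemma tilde_in_tilde_algebra:
  assumes "A \<in> gen_algebra \<Omega> G"
  shows "tilde \<Omega> G A \<in> tilde_algebra \<Omega> G"
proof (cases "A = {}")
  case True
  interpret algebra "nonempty_events \<Omega> G" "tilde_algebra \<Omega> G"
    by (rule algebra_tilde_algebra)
  show ?thesis using True by (simp add: tilde_empty)
next
  case False
  then have "A \<in> nonempty_events \<Omega> G"
    using assms by (simp add: nonempty_events_def)
  then show ?thesis
    unfolding tilde_algebra_def using gen_algebra_subset by blast
qed

subsection \<open>Finitely additive probabilities\<close>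

lemma fin_additive_prob_empty:
  assumes "algebra X M" "fin_additive_prob X M \<mu>"
  shows "\<mu> {} = 0"
proof -
  interpret algebra X M by fact
  have "\<mu> ({} \<union> {}) = \<mu> {} + \<mu> {}"
    using assms(2) unfolding fin_additive_prob_def additive_def by blast
  then show ?thesis by simp
qed

lemma fin_additive_prob_nonneg: "fin_additive_prob X M \<mu> \<Longrightarrow> A \<in> M \<Longrightarrow> 0 \<le> \<mu> A"
  by (auto simp: fin_additive_prob_def)

lemma fin_additive_prob_mono:
  assumes "algebra X M" "fin_additive_prob X M \<mu>" "A \<in> M" "B \<in> M" "A \<subseteq> B"
  shows "\<mu> A \<le> \<mu> B"
proof -
  interpret algebra X M by fact
  have "\<mu> (A \<union> (B - A)) = \<mu> A + \<mu> (B - A)"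
    using assms unfolding fin_additive_prob_def additive_def by blast
  moreover have "A \<union> (B - A) = B" using assms by auto
  ultimately show ?thesis
    using fin_additive_prob_nonneg[OF assms(2), of "B - A"] assms by auto
qed

text \<open>When \<open>P\<close> partitions the space, this splits \<open>\<mu> T\<close> along
  \<open>P\<close>; Darboux sums are then compared with it cell by cell.\<close>

lemma fin_additive_prob_sum_Int:
  assumes "algebra X M" "fin_additive_prob X M \<mu>" "finite P" "P \<subseteq> M" "disjoint P" "T \<in> M"
  shows "(\<Sum>A\<in>P. \<mu> (A \<inter> T)) = \<mu> (\<Union>P \<inter> T)"
  using assms(3-5)
proof (induction P rule: finite_induct)
  case empty
  show ?case using fin_additive_prob_empty[OF assms(1,2)] by simp
next
  case (insert A P)
  interpret algebra X M by fact
  have "\<Union>P \<in> M" using insert by auto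
  moreover have "(A \<inter> T) \<inter> (\<Union>P \<inter> T) = {}"
    using insert by (auto simp: pairwise_insert disjnt_def)
  ultimately have "\<mu> ((A \<inter> T) \<union> (\<Union>P \<inter> T)) = \<mu> (A \<inter> T) + \<mu> (\<Union>P \<inter> T)"
    using assms(2,6) insert.prems unfolding fin_additive_prob_def additive_def
    by (metis Int insertI1 subsetD)
  moreover have "(A \<inter> T) \<union> (\<Union>P \<inter> T) = \<Union>(insert A P) \<inter> T" by auto
  ultimately show ?case using insert by (simp add: pairwise_insert)
qed

text \<open>Gives access to the library's inclusion-exclusion formula for finitely additive set
  functions on an algebra.\<close>

lemma fin_additive_prob_Incl_Excl:
  assumes "algebra X M" "fin_additive_prob X M \<mu>"
  shows "Incl_Excl (\<lambda>A. A \<in> M) \<mu>"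
proof -
  interpret algebra X M by fact
  show ?thesis
    using assms(2) by unfold_locales (auto simp: fin_additive_prob_def additive_def disjnt_def)
qed

section \<open>Stieltjes integrals of indicators\<close>

text \<open>For every partition, \<open>\<mu> T\<close> is the sum of
  \<open>\<mu> (A \<inter> T)\<close> over the cells, which lies between the lower and the upper
  sum. Both sums equal \<open>\<mu> T\<close> on the partition into \<open>T\<close> and its
  complement, so the supremum and the infimum are attained there.\<close>

lemma has_stieltjes_integral_indicator:
  fixes f :: "'b \<Rightarrow> real"
  assumes "algebra X M" "fin_additive_prob X M \<mu>" "T \<in> M"
    and f: "\<And>x. x \<in> X \<Longrightarrow> f x = of_bool (x \<in> T)"
  shows "has_stieltjes_integral X M \<mu> f (\<mu> T)"
proof -
  interpret algebra X M by fact
  have TX: "T \<subseteq> X" using assms(3) by (rule sets_into_space)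
  have sum: "(\<Sum>A\<in>P. \<mu> (A \<inter> T)) = \<mu> T" if "P \<in> finite_partitions X M" for P
    using fin_additive_prob_sum_Int[OF assms(1,2) _ _ _ assms(3), of P] that TX
    by (auto simp: finite_partitions_def partition_on_def Int_absorb1)
  have inside: "(INF x\<in>A. f x) = 1" "(SUP x\<in>A. f x) = 1" if "A \<noteq> {}" "A \<subseteq> T" for A
  proof -
    have "f ` A = {1}" using that f TX by force
    then show "(INF x\<in>A. f x) = 1" "(SUP x\<in>A. f x) = 1" by auto
  qed
  have outside: "(INF x\<in>A. f x) = 0" "(SUP x\<in>A. f x) = 0"
    if "A \<noteq> {}" "A \<subseteq> X" "A \<inter> T = {}" for A
  proof -
    have "f ` A = {0}" using that f by force
    then show "(INF x\<in>A. f x) = 0" "(SUP x\<in>A. f x) = 0" by auto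
  qed
  \<comment> \<open>Only cells that straddle \<open>T\<close> separate the two sums; for them
    \<open>bound\<close> amounts to
    \<open>0 \<le> \<mu> (A \<inter> T) \<le> \<mu> A\<close>.\<close>
  have mixed: "(INF x\<in>A. f x) = 0" "(SUP x\<in>A. f x) = 1"
    if "A \<subseteq> X" "A \<inter> T \<noteq> {}" "\<not> A \<subseteq> T" for A
  proof -
    have "f ` A = {0, 1}"
    proof
      show "f ` A \<subseteq> {0, 1}" using that f by auto
      show "{0, 1} \<subseteq> f ` A" using that f by (force simp: image_iff)
    qed
    then show "(INF x\<in>A. f x) = 0" "(SUP x\<in>A. f x) = 1"
      by (auto simp: cInf_eq_Min cSup_eq_Max)
  qed
  have empty: "\<mu> {} = 0" using assms(1,2) by (rule fin_additive_prob_empty)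
  have pure: "(INF x\<in>A. f x) * \<mu> A = \<mu> (A \<inter> T)" "(SUP x\<in>A. f x) * \<mu> A = \<mu> (A \<inter> T)"
    if "A \<in> M" "A \<noteq> {}" "A \<subseteq> T \<or> A \<inter> T = {}" for A
    using that inside[of A] outside[of A] sets_into_space[OF that(1)] empty
    by (auto simp: Int_absorb2)
  have bound: "(INF x\<in>A. f x) * \<mu> A \<le> \<mu> (A \<inter> T)" "\<mu> (A \<inter> T) \<le> (SUP x\<in>A. f x) * \<mu> A"
    if "A \<in> M" "A \<noteq> {}" for A
  proof -
    have "A \<inter> T \<in> M" using that assms(3) by auto
    then have "0 \<le> \<mu> (A \<inter> T)" "\<mu> (A \<inter> T) \<le> \<mu> A"
      using fin_additive_prob_nonneg[OF assms(2)]
        fin_additive_prob_mono[OF assms(1,2) _ that(1)] by auto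
    then show "(INF x\<in>A. f x) * \<mu> A \<le> \<mu> (A \<inter> T)" "\<mu> (A \<inter> T) \<le> (SUP x\<in>A. f x) * \<mu> A"
      using that pure[of A] mixed[of A] sets_into_space[OF that(1)]
      by (cases "A \<subseteq> T \<or> A \<inter> T = {}"; simp)+
  qed
  \<comment> \<open>The optimal partition. Either of \<open>T\<close> and \<open>X - T\<close> may
    be empty, and \<open>partition_on\<close> forbids empty cells.\<close>
  define Q where "Q = {T, X - T} - {{}}"
  have Q: "Q \<in> finite_partitions X M"
    using assms(3) TX
    by (auto simp: Q_def finite_partitions_def partition_on_def disjoint_def)
  have Q_pure: "A \<in> M" "A \<noteq> {}" "A \<subseteq> T \<or> A \<inter> T = {}" if "A \<in> Q" for A
    using that assms(3) by (auto simp: Q_def)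
  have P: "A \<in> M" "A \<noteq> {}" if "P \<in> finite_partitions X M" "A \<in> P" for P A
    using that by (auto simp: finite_partitions_def partition_on_def)
  have "lower_stieltjes X M \<mu> f = \<mu> T"
    unfolding lower_stieltjes_def
  proof (rule cSup_eq_maximum)
    have "(\<Sum>A\<in>Q. (INF x\<in>A. f x) * \<mu> A) = \<mu> T"
      using sum[OF Q] pure(1) Q_pure by simp
    then show "\<mu> T \<in> (\<lambda>P. \<Sum>A\<in>P. (INF x\<in>A. f x) * \<mu> A) ` finite_partitions X M"
      using Q by (metis imageI)
  next
    fix y assume "y \<in> (\<lambda>P. \<Sum>A\<in>P. (INF x\<in>A. f x) * \<mu> A) ` finite_partitions X M"
    then obtain P where Pf: "P \<in> finite_partitions X M"
      and y: "y = (\<Sum>A\<in>P. (INF x\<in>A. f x) * \<mu> A)"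
      by blast
    have "y \<le> (\<Sum>A\<in>P. \<mu> (A \<inter> T))"
      unfolding y by (intro sum_mono bound P[OF Pf])
    then show "y \<le> \<mu> T" using sum[OF Pf] by simp
  qed
  moreover have "upper_stieltjes X M \<mu> f = \<mu> T"
    unfolding upper_stieltjes_def
  proof (rule cInf_eq_minimum)
    have "(\<Sum>A\<in>Q. (SUP x\<in>A. f x) * \<mu> A) = \<mu> T"
      using sum[OF Q] pure(2) Q_pure by simp
    then show "\<mu> T \<in> (\<lambda>P. \<Sum>A\<in>P. (SUP x\<in>A. f x) * \<mu> A) ` finite_partitions X M"
      using Q by (metis imageI)
  next
    fix y assume "y \<in> (\<lambda>P. \<Sum>A\<in>P. (SUP x\<in>A. f x) * \<mu> A) ` finite_partitions X M"
    then obtain P where Pf: "P \<in> finite_partitions X M"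
      and y: "y = (\<Sum>A\<in>P. (SUP x\<in>A. f x) * \<mu> A)"
      by blast
    have "(\<Sum>A\<in>P. \<mu> (A \<inter> T)) \<le> y"
      unfolding y by (intro sum_mono bound P[OF Pf])
    then show "\<mu> T \<le> y" using sum[OF Pf] by simp
  qed
  moreover have "f ` X \<subseteq> {0..1}" using f by auto
  then have "bounded (f ` X)" by (rule bounded_subset[OF bounded_closed_interval])
  ultimately show ?thesis by (simp add: has_stieltjes_integral_def)
qed

text \<open>On non-empty events \<open>min_indicator E\<close> is the indicator of
  \<open>tilde \<Omega> \<E> E\<close>, and the value of an integral is unique. Integrals can thus
  be dropped from all later arguments.\<close>

lemma coherent2_iff:
  assumes "\<E> \<subseteq> Pow \<Omega>"
  shows "coherent2 \<Omega> \<E> Bel \<longleftrightarrow>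
    (\<exists>\<mu>. fin_additive_prob (nonempty_events \<Omega> \<E>) (tilde_algebra \<Omega> \<E>) \<mu> \<and>
       (\<forall>E\<in>\<E>. \<mu> (tilde \<Omega> \<E> E) = Bel E))"
proof -
  have "has_stieltjes_integral (nonempty_events \<Omega> \<E>) (tilde_algebra \<Omega> \<E>) \<mu>
      (\<lambda>B. min_indicator E B) (Bel E) \<longleftrightarrow> \<mu> (tilde \<Omega> \<E> E) = Bel E"
    if "fin_additive_prob (nonempty_events \<Omega> \<E>) (tilde_algebra \<Omega> \<E>) \<mu>" "E \<in> \<E>" for \<mu> E
  proof -
    have "E \<in> gen_algebra \<Omega> \<E>" using that gen_algebra_subset by blast
    then have "has_stieltjes_integral (nonempty_events \<Omega> \<E>) (tilde_algebra \<Omega> \<E>) \<mu>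
      (\<lambda>B. min_indicator E B) (\<mu> (tilde \<Omega> \<E> E))"
      by (intro has_stieltjes_integral_indicator algebra_tilde_algebra that tilde_in_tilde_algebra)
        (auto simp: min_indicator_nonempty_events tilde_def)
    then show ?thesis by (auto simp: has_stieltjes_integral_def)
  qed
  then show ?thesis unfolding coherent2_def by (intro ex_cong1 conj_cong refl ball_cong) auto
qed

subsection \<open>From coherent-2 to coherent-1\<close>

lemma coherent2_imp_coherent1:
  assumes "\<E> \<subseteq> Pow \<Omega>" "coherent2 \<Omega> \<E> Bel"
  shows "coherent1 \<Omega> \<E> Bel"
proof -
  obtain \<mu> where \<mu>: "fin_additive_prob (nonempty_events \<Omega> \<E>) (tilde_algebra \<Omega> \<E>) \<mu>"
    and Bel: "\<And>E. E \<in> \<E> \<Longrightarrow> \<mu> (tilde \<Omega> \<E> E) = Bel E"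
    using assms(2) unfolding coherent2_iff[OF assms(1)] by blast
  interpret A: algebra \<Omega> "gen_algebra \<Omega> \<E>"
    using assms(1) by (rule algebra_gen_algebra)
  interpret T: algebra "nonempty_events \<Omega> \<E>" "tilde_algebra \<Omega> \<E>"
    by (rule algebra_tilde_algebra)
  interpret IE: Incl_Excl "\<lambda>A. A \<in> tilde_algebra \<Omega> \<E>" \<mu>
    using T.algebra_axioms \<mu> by (rule fin_additive_prob_Incl_Excl)
  have "belief_function \<Omega> (gen_algebra \<Omega> \<E>) (\<lambda>A. \<mu> (tilde \<Omega> \<E> A))"
    unfolding belief_function_def
  proof (intro conjI allI impI)
    show "(\<lambda>A. \<mu> (tilde \<Omega> \<E> A)) \<in> gen_algebra \<Omega> \<E> \<rightarrow> {0..1}"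
      using \<mu> tilde_in_tilde_algebra by (fastforce simp: fin_additive_prob_def)
    show "\<mu> (tilde \<Omega> \<E> {}) = 0" by (simp add: tilde_empty)
    show "\<mu> (tilde \<Omega> \<E> \<Omega>) = 1"
      using \<mu> by (simp add: tilde_space[OF assms(1)] fin_additive_prob_def)
  next
    fix k :: nat and A :: "nat \<Rightarrow> 'a set"
    assume "2 \<le> k" and A: "A \<in> {1..k} \<rightarrow> gen_algebra \<Omega> \<E>"
    have tA: "tilde \<Omega> \<E> (A i) \<in> tilde_algebra \<Omega> \<E>" if "i \<in> {1..k}" for i
      using A that by (intro tilde_in_tilde_algebra) auto
    \<comment> \<open>An event lies below an intersection iff it lies below each member.
      \<open>I\<close> must be non-empty, since an empty intersection is \<open>UNIV\<close> on
      either side.\<close>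
    have INT: "tilde \<Omega> \<E> (\<Inter>i\<in>I. A i) = (\<Inter>i\<in>I. tilde \<Omega> \<E> (A i))" if "I \<noteq> {}" for I
      using that by (auto simp: tilde_def)
    have "(\<Sum>I\<in>Pow {1..k} - {{}}. (- 1) ^ (card I + 1) * \<mu> (tilde \<Omega> \<E> (\<Inter>i\<in>I. A i)))
        = (\<Sum>I | I \<subseteq> {1..k} \<and> I \<noteq> {}.
            (- 1) ^ (card I + 1) * \<mu> (\<Inter>i\<in>I. tilde \<Omega> \<E> (A i)))"
      by (intro sum.cong) (auto simp: INT)
    also have "\<dots> = \<mu> (\<Union>i\<in>{1..k}. tilde \<Omega> \<E> (A i))"
      using tA by (intro IE.restricted_indexed[symmetric]) auto
    \<comment> \<open>Equality is lost here: an event contained in the union need not be contained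
      in any single \<open>A i\<close>.\<close>
    also have "\<dots> \<le> \<mu> (tilde \<Omega> \<E> (\<Union>i\<in>{1..k}. A i))"
    proof (rule fin_additive_prob_mono[OF T.algebra_axioms \<mu>])
      show "(\<Union>i\<in>{1..k}. tilde \<Omega> \<E> (A i)) \<in> tilde_algebra \<Omega> \<E>"
        using tA by auto
      show "tilde \<Omega> \<E> (\<Union>i\<in>{1..k}. A i) \<in> tilde_algebra \<Omega> \<E>"
        using A by (intro tilde_in_tilde_algebra A.finite_UN) auto
    qed (auto simp: tilde_def)
    finally show "(\<Sum>I\<in>Pow {1..k} - {{}}. (- 1) ^ (card I + 1) * \<mu> (tilde \<Omega> \<E> (\<Inter>i\<in>I. A i)))
        \<le> \<mu> (tilde \<Omega> \<E> (\<Union>i\<in>{1..k}. A i))" .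
  qed
  then show ?thesis unfolding coherent1_def using Bel by metis
qed

subsection \<open>From coherent-1 to coherent-3\<close>

text \<open>A maximal member \<open>C\<close> of \<open>U\<close> lies below no other member, so
  \<open>m C\<close> occurs only in the equation for \<open>C\<close>. The other equations are
  solved first, by induction, and \<open>m C\<close> is then set to what its own equation
  demands.\<close>

lemma finite_Moebius_inverse:
  fixes g :: "'a set \<Rightarrow> real"
  assumes "finite U"
  shows "\<exists>m. \<forall>B\<in>U. (\<Sum>A | A \<in> U \<and> A \<subseteq> B. m A) = g B"
  using assms
proof (induction U rule: finite_psubset_induct)
  case (psubset U)
  show ?case
  proof (cases "U = {}")
    case False
    then obtain C where C: "C \<in> U" "\<And>A. A \<in> U \<Longrightarrow> C \<subseteq> A \<Longrightarrow> A = C"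
      using finite_has_maximal[OF psubset.hyps] by metis
    then obtain m where m: "\<And>B. B \<in> U - {C} \<Longrightarrow> (\<Sum>A | A \<in> U - {C} \<and> A \<subseteq> B. m A) = g B"
      using psubset.IH[of "U - {C}"] by blast
    let ?m = "m(C := g C - (\<Sum>A | A \<in> U - {C} \<and> A \<subseteq> C. m A))"
    have "(\<Sum>A | A \<in> U \<and> A \<subseteq> B. ?m A) = g B" if B: "B \<in> U" for B
    proof (cases "B = C")
      case True
      have "{A. A \<in> U \<and> A \<subseteq> C} = insert C {A. A \<in> U - {C} \<and> A \<subseteq> C}" using C by auto
      moreover have "(\<Sum>A | A \<in> U - {C} \<and> A \<subseteq> C. ?m A) = (\<Sum>A | A \<in> U - {C} \<and> A \<subseteq> C. m A)"
        by (intro sum.cong) auto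
      ultimately show ?thesis using True psubset.hyps by simp
    next
      case False
      then have "{A. A \<in> U \<and> A \<subseteq> B} = {A. A \<in> U - {C} \<and> A \<subseteq> B}" using C B by auto
      moreover have "(\<Sum>A | A \<in> U - {C} \<and> A \<subseteq> B. ?m A) = (\<Sum>A | A \<in> U - {C} \<and> A \<subseteq> B. m A)"
        by (intro sum.cong) auto
      ultimately show ?thesis using m[of B] False B by simp
    qed
    then show ?thesis by blast
  qed simp
qed

lemma belief_function_subset:
  "belief_function \<Omega> M \<beta> \<Longrightarrow> N \<subseteq> M \<Longrightarrow> belief_function \<Omega> N \<beta>"
  unfolding belief_function_def by (blast intro: Pi_mono)

text \<open>The case \<open>k = 2\<close> for the disjoint sets \<open>C\<close> and
  \<open>D - C\<close> gives \<open>\<beta> C + \<beta> (D - C) \<le> \<beta> D\<close>.\<close>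

lemma belief_function_mono:
  assumes "algebra \<Omega> M" "belief_function \<Omega> M \<beta>" "C \<in> M" "D \<in> M" "C \<subseteq> D"
  shows "\<beta> C \<le> \<beta> D"
proof -
  interpret algebra \<Omega> M by fact
  let ?A = "\<lambda>i::nat. if i = 1 then C else D - C"
  have A: "?A \<in> {1..2} \<rightarrow> M" using assms by auto
  have "(\<Sum>I\<in>Pow {1..2} - {{}}. (- 1) ^ (card I + 1) * \<beta> (\<Inter>i\<in>I. ?A i)) \<le> \<beta> (\<Union>i\<in>{1..2}. ?A i)"
    using assms(2)[unfolded belief_function_def] A by blast
  moreover have "{1..2} = {1, 2::nat}" by auto
  moreover have "Pow {1, 2::nat} - {{}} = {{1}, {2}, {1, 2}}" by (auto simp: Pow_insert)
  moreover have "{1} \<noteq> {2::nat}" "{1} \<noteq> {1, 2::nat}" "{2} \<noteq> {1, 2::nat}" by auto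
  ultimately have "\<beta> C + \<beta> (D - C) - \<beta> (C \<inter> (D - C)) \<le> \<beta> (C \<union> (D - C))"
    by (simp add: Int_commute)
  then have "\<beta> C + \<beta> (D - C) - \<beta> {} \<le> \<beta> D"
    using assms(5) by (simp add: Int_Diff_disjoint Un_absorb1)
  moreover have "\<beta> {} = 0" "\<beta> (D - C) \<ge> 0"
    using assms by (auto simp: belief_function_def)
  ultimately show ?thesis by simp
qed

text \<open>
  The down-sets of the proper subsets of \<open>B\<close> cover all events properly contained in \<open>B\<close>, so by
  inclusion-exclusion the masses of these add up to at most \<open>\<beta> B\<close>. The enumeration of the proper
  subsets is padded with \<open>{}\<close> since the inequality for belief functions needs at least two sets.
\<close>

lemma belief_function_mass:
  assumes "algebra \<Omega> M" "finite M" "belief_function \<Omega> M \<beta>"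
  shows "\<exists>m. (\<forall>B\<in>M. (\<Sum>A | A \<in> M - {{}} \<and> A \<subseteq> B. m A) = \<beta> B) \<and> (\<forall>B\<in>M - {{}}. m B \<ge> 0)"
proof -
  interpret algebra \<Omega> M by fact
  have fin: "finite (M - {{}})" using assms by simp
  obtain m where m: "\<And>B. B \<in> M - {{}} \<Longrightarrow> (\<Sum>A | A \<in> M - {{}} \<and> A \<subseteq> B. m A) = \<beta> B"
    using finite_Moebius_inverse[OF fin] by metis
  have \<beta>0: "\<beta> {} = 0" using assms by (simp add: belief_function_def)
  \<comment> \<open>The equation is extended to \<open>B = {}\<close>, where both sides vanish,
    because intersections of proper subsets of an event may be empty.\<close>
  have m': "(\<Sum>A | A \<in> M - {{}} \<and> A \<subseteq> B. m A) = \<beta> B" if "B \<in> M" for B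
  proof (cases "B = {}")
    case True
    then have "{A. A \<in> M - {{}} \<and> A \<subseteq> B} = {}" by auto
    then show ?thesis using \<beta>0 True by (metis sum.empty)
  qed (use m that in auto)
  have "m B \<ge> 0" if B: "B \<in> M - {{}}" for B
  proof -
    let ?down = "\<lambda>C. {A. A \<in> M - {{}} \<and> A \<subseteq> C}"
    let ?S = "{A \<in> M. A \<subset> B}"
    interpret IE: Incl_Excl "\<lambda>S. S \<subseteq> M - {{}}" "\<lambda>S. sum m S"
      by unfold_locales
        (auto simp: disjnt_def intro!: sum.union_disjoint intro: finite_subset[OF _ fin])
    have finS: "finite ?S" using assms by simp
    obtain h where h: "bij_betw h {0..<card ?S} ?S"
      using ex_bij_betw_nat_finite[OF finS] by blast
    define k where "k = card ?S + 2"
    define C where "C i = (if i < card ?S then h i else {})" for i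
    have "h i \<in> ?S" if "i < card ?S" for i
      using h that by (auto simp: bij_betw_def)
    then have C: "C i \<in> ?S" for i using B by (auto simp: C_def)
    \<comment> \<open>\<open>C\<close> is enumerated from 0, whereas the sets in
      \<open>belief_function\<close> are numbered from 1.\<close>
    define D where "D i = C (i - 1)" for i
    have D: "D i \<in> M" "D i \<subset> B" for i using C by (auto simp: D_def)
    have surj: "\<exists>i\<in>{1..k}. D i = A" if "A \<in> ?S" for A
    proof -
      obtain i where "i < card ?S" "h i = A"
        using h \<open>A \<in> ?S\<close> unfolding bij_betw_def
        by (metis (no_types, lifting) atLeastLessThan_iff imageE)
      then have "Suc i \<in> {1..k}" "D (Suc i) = A" by (auto simp: k_def D_def C_def)
      then show ?thesis by blast
    qed
    have INT: "sum m (\<Inter>i\<in>I. ?down (D i)) = \<beta> (\<Inter>i\<in>I. D i)" if I: "I \<subseteq> {1..k}" "I \<noteq> {}" for I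
    proof -
      have "(\<Inter>i\<in>I. ?down (D i)) = ?down (\<Inter>i\<in>I. D i)" using I by auto
      moreover have "(\<Inter>i\<in>I. D i) \<in> M"
        using I D finite_subset[OF I(1)] by (intro finite_INT) auto
      ultimately show ?thesis using m' by simp
    qed
    \<comment> \<open>This isolates \<open>m B\<close> in the equation for \<open>\<beta> B\<close>:
      every other event below \<open>B\<close> is itself one of the \<open>D i\<close>.\<close>
    have "?down B = insert B (\<Union>i\<in>{1..k}. ?down (D i))"
    proof
      show "?down B \<subseteq> insert B (\<Union>i\<in>{1..k}. ?down (D i))"
      proof
        fix A assume A: "A \<in> ?down B"
        show "A \<in> insert B (\<Union>i\<in>{1..k}. ?down (D i))"
        proof (cases "A = B")
          case False
          with A have "A \<in> ?S" by blast
          then obtain i where "i \<in> {1..k}" "D i = A" using surj by blast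
          then show ?thesis using A by blast
        qed simp
      qed
      show "insert B (\<Union>i\<in>{1..k}. ?down (D i)) \<subseteq> ?down B" using B D by blast
    qed
    moreover have "B \<notin> (\<Union>i\<in>{1..k}. ?down (D i))" using D by blast
    moreover have "finite (\<Union>i\<in>{1..k}. ?down (D i))" using fin by simp
    ultimately have "\<beta> B = m B + sum m (\<Union>i\<in>{1..k}. ?down (D i))"
      using m[OF B] by simp
    moreover have "sum m (\<Union>i\<in>{1..k}. ?down (D i)) =
        (\<Sum>I | I \<subseteq> {1..k} \<and> I \<noteq> {}. (- 1) ^ (card I + 1) * sum m (\<Inter>i\<in>I. ?down (D i)))"
      by (rule IE.restricted_indexed) auto
    moreover have "\<dots> = (\<Sum>I\<in>Pow {1..k} - {{}}. (- 1) ^ (card I + 1) * \<beta> (\<Inter>i\<in>I. D i))"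
      by (intro sum.cong arg_cong2[where f = "(*)"] refl INT) auto
    moreover have "\<dots> \<le> \<beta> (\<Union>i\<in>{1..k}. D i)"
    proof -
      have "2 \<le> k" "D \<in> {1..k} \<rightarrow> M" using D by (auto simp: k_def)
      then show ?thesis using assms(3) unfolding belief_function_def by blast
    qed
    moreover have "\<dots> \<le> \<beta> B"
    proof (rule belief_function_mono[OF assms(1,3)])
      show "(\<Union>i\<in>{1..k}. D i) \<in> M" using D by blast
    qed (use B D in auto)
    ultimately show ?thesis by linarith
  qed
  with m' show ?thesis by blast
qed

lemma coherent1_imp_coherent3:
  assumes "\<E> \<subseteq> Pow \<Omega>" "coherent1 \<Omega> \<E> Bel"
  shows "coherent3 \<Omega> \<E> Bel"
  unfolding coherent3_def
proof (intro allI impI)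
  fix \<F> assume \<F>: "finite \<F> \<and> \<F> \<noteq> {} \<and> \<F> \<subseteq> \<E>"
  let ?U = "nonempty_events \<Omega> \<F>"
  have Pow: "\<F> \<subseteq> Pow \<Omega>" using \<F> assms by auto
  obtain \<beta> where \<beta>: "belief_function \<Omega> (gen_algebra \<Omega> \<E>) \<beta>" "\<And>E. E \<in> \<E> \<Longrightarrow> Bel E = \<beta> E"
    using assms unfolding coherent1_def by blast
  have \<beta>F: "belief_function \<Omega> (gen_algebra \<Omega> \<F>) \<beta>"
    using \<beta>(1) gen_algebra_mono \<F> by (blast intro: belief_function_subset)
  have fin: "finite ?U" using finite_nonempty_events \<F> Pow by blast
  interpret algebra \<Omega> "gen_algebra \<Omega> \<F>" using Pow by (rule algebra_gen_algebra)
  have "finite (gen_algebra \<Omega> \<F>)" using fin by (simp add: nonempty_events_def)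
  then obtain m where m: "\<And>B. B \<in> gen_algebra \<Omega> \<F> \<Longrightarrow> (\<Sum>A | A \<in> ?U \<and> A \<subseteq> B. m A) = \<beta> B"
    "\<And>B. B \<in> ?U \<Longrightarrow> m B \<ge> 0"
    using belief_function_mass[OF algebra_axioms _ \<beta>F]
    unfolding nonempty_events_def by blast
  have "(\<Sum>B\<in>?U. min_indicator E B * m B) = Bel E" if "E \<in> \<F>" for E
  proof -
    have "(\<Sum>B\<in>?U. min_indicator E B * m B) = (\<Sum>B\<in>?U. if B \<subseteq> E then m B else 0)"
      by (intro sum.cong) (auto simp: min_indicator_nonempty_events)
    also have "\<dots> = (\<Sum>A | A \<in> ?U \<and> A \<subseteq> E. m A)"
      using fin by (simp add: sum.inter_filter)
    also have "\<dots> = Bel E"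
      using m(1) that gen_algebra_subset \<beta>(2) \<F> by (metis subsetD)
    finally show ?thesis .
  qed
  \<comment> \<open>Total mass 1 is the mass equation at \<open>\<Omega>\<close>, below which every
    event lies.\<close>
  moreover have "{A. A \<in> ?U \<and> A \<subseteq> \<Omega>} = ?U"
    using tilde_space[OF Pow] by (simp add: tilde_def)
  then have "sum m ?U = 1"
    using m(1)[OF top] \<beta> by (simp add: belief_function_def)
  ultimately show "\<exists>x. (\<forall>E\<in>\<F>. (\<Sum>B\<in>?U. min_indicator E B * x B) = Bel E) \<and>
      sum x ?U = 1 \<and> (\<forall>B\<in>?U. x B \<ge> 0)"
    using m(2) by blast
qed

subsection \<open>From coherent-3 to coherent-2\<close>

text \<open>Tychonoff's theorem: the set is a product of unit intervals, and the topology of the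
  function type is the product topology.\<close>

lemma compact_unit_functions: "compact {f :: 'b \<Rightarrow> real. \<forall>x. f x \<in> {0..1}}"
proof -
  have "compactin (product_topology (\<lambda>_. euclidean) UNIV) (PiE UNIV (\<lambda>_ :: 'b. {0..1 :: real}))"
    unfolding compactin_PiE by simp
  moreover have "PiE UNIV (\<lambda>_ :: 'b. {0..1 :: real}) = {f. \<forall>x. f x \<in> {0..1}}"
    by (auto simp: PiE_def Pi_def)
  ultimately show ?thesis by (simp add: euclidean_product_topology)
qed

lemma coherent3_imp_coherent2:
  assumes "\<E> \<subseteq> Pow \<Omega>" "\<E> \<noteq> {}" "coherent3 \<Omega> \<E> Bel"
  shows "coherent2 \<Omega> \<E> Bel"
proof -
  let ?U = "nonempty_events \<Omega> \<E>"
  let ?K = "{\<mu> :: 'a set set \<Rightarrow> real. \<forall>S. \<mu> S \<in> {0..1}}"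
  \<comment> \<open>Additivity is required of all disjoint pairs, not only of members of the
    algebra, so that set functions are points of one cube. Each condition involves finitely many
    coordinates and is therefore closed.\<close>
  define add where "add = {\<mu> :: 'a set set \<Rightarrow> real. \<mu> ?U = 1 \<and>
    (\<forall>S T. S \<inter> T = {} \<longrightarrow> \<mu> (S \<union> T) = \<mu> S + \<mu> T)}"
  \<comment> \<open>Building \<open>add\<close> into every \<open>ext E\<close> leaves one closed
    family indexed by \<open>\<E>\<close>; as \<open>\<E>\<close> is non-empty, \<open>add\<close>
    is recovered from any member.\<close>
  define ext where "ext E = {\<mu> :: 'a set set \<Rightarrow> real. \<mu> (tilde \<Omega> \<E> E) = Bel E} \<inter> add" for E
  have "closed add"
    unfolding add_def
    by (intro closed_Collect_conj closed_Collect_all closed_Collect_imp open_Collect_const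
        closed_Collect_eq continuous_intros) simp_all
  then have closed_ext: "closed (ext E)" for E
    unfolding ext_def by (intro closed_Int closed_Collect_eq continuous_intros) simp_all
  have fip: "?K \<inter> (\<Inter>E\<in>\<F>. ext E) \<noteq> {}" if \<F>: "finite \<F>" "\<F> \<subseteq> \<E>" for \<F>
  proof (cases "\<F> = {}")
    case True
    \<comment> \<open>The intersection over no events is everything, so any point of the cube will
      do; coherent-3 speaks of non-empty families only.\<close>
    have "(\<lambda>_. 0) \<in> ?K" by simp
    then show ?thesis using True by auto
  next
    case False
    let ?V = "nonempty_events \<Omega> \<F>"
    obtain x where x: "\<And>E. E \<in> \<F> \<Longrightarrow> (\<Sum>B\<in>?V. min_indicator E B * x B) = Bel E"
      "sum x ?V = 1" "\<And>B. B \<in> ?V \<Longrightarrow> x B \<ge> 0"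
      using assms(3) \<F> False unfolding coherent3_def by meson
    have fin: "finite ?V" using finite_nonempty_events \<F> assms by (metis subset_trans)
    have VU: "?V \<subseteq> ?U" using \<F> by (intro nonempty_events_mono)
    \<comment> \<open>The solution is read as point masses on \<open>?V\<close>; since
      \<open>?V \<subseteq> ?U\<close>, this measure lives on the events of the larger
      algebra.\<close>
    define \<mu> where "\<mu> S = sum x (?V \<inter> S)" for S
    have "\<mu> \<in> ?K"
    proof -
      have "\<mu> S \<le> sum x ?V" "0 \<le> \<mu> S" for S
        unfolding \<mu>_def using fin x(3) by (auto intro!: sum_mono2 sum_nonneg)
      then show ?thesis using x(2) by simp
    qed
    moreover have "\<mu> \<in> add"
    proof -
      have "\<mu> (S \<union> T) = \<mu> S + \<mu> T" if "S \<inter> T = {}" for S T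
        unfolding \<mu>_def Int_Un_distrib using fin that by (intro sum.union_disjoint) auto
      moreover have "\<mu> ?U = 1" using VU x(2) by (simp add: \<mu>_def Int_absorb2)
      ultimately show ?thesis by (simp add: add_def)
    qed
    moreover have "\<mu> (tilde \<Omega> \<E> E) = Bel E" if "E \<in> \<F>" for E
    proof -
      have "?V \<inter> tilde \<Omega> \<E> E = {B \<in> ?V. B \<subseteq> E}" using VU by (auto simp: tilde_def)
      then have "\<mu> (tilde \<Omega> \<E> E) = (\<Sum>B\<in>?V. if B \<subseteq> E then x B else 0)"
        using fin by (simp add: \<mu>_def sum.inter_filter)
      also have "\<dots> = (\<Sum>B\<in>?V. min_indicator E B * x B)"
        by (intro sum.cong) (auto simp: min_indicator_nonempty_events)
      finally show ?thesis using x(1) that by simp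
    qed
    ultimately have "\<mu> \<in> ?K \<inter> (\<Inter>E\<in>\<F>. ext E)" unfolding ext_def by blast
    then show ?thesis by blast
  qed
  have "?K \<inter> (\<Inter>E\<in>\<E>. ext E) \<noteq> {}"
    by (rule compact_imp_fip_image[OF compact_unit_functions]) (rule closed_ext fip; assumption)+
  then obtain \<mu> where "\<mu> \<in> ?K" and \<mu>: "\<And>E. E \<in> \<E> \<Longrightarrow> \<mu> \<in> ext E" by blast
  moreover from \<mu> assms(2) have "\<mu> \<in> add" by (auto simp: ext_def)
  ultimately have "fin_additive_prob ?U (tilde_algebra \<Omega> \<E>) \<mu>"
    by (auto simp: fin_additive_prob_def add_def additive_def)
  with \<mu> show ?thesis
    unfolding coherent2_iff[OF assms(1)] by (auto simp: ext_def)
qed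

subsection \<open>Gains and quadratic losses\<close>

text \<open>The last conclusion is the variational inequality of the projection of \<open>b\<close>
  onto the convex hull of the vectors \<open>\<lambda>E. m E B\<close>: seen from the nearest point,
  \<open>b\<close> and a vertex never form an acute angle. The minimum is taken over the weights,
  which range over a compact set.\<close>

lemma convex_hull_nearest_point:
  fixes m :: "'e \<Rightarrow> 'b \<Rightarrow> real" and b :: "'e \<Rightarrow> real"
  assumes "finite U" "U \<noteq> {}"
  obtains x where "\<And>B. B \<in> U \<Longrightarrow> 0 \<le> x B" "sum x U = 1"
    "\<And>B. B \<in> U \<Longrightarrow>
      (\<Sum>E\<in>F. (b E - (\<Sum>C\<in>U. m E C * x C)) * (m E B - (\<Sum>C\<in>U. m E C * x C))) \<le> 0"
proof -
  \<comment> \<open>Weights off \<open>U\<close> also stay in the unit interval, which makes this a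
    closed subset of the compact cube.\<close>
  define \<Delta> where "\<Delta> = {x :: 'b \<Rightarrow> real. \<forall>B. x B \<in> {0..1}} \<inter> {x. sum x U = 1}"
  let ?p = "\<lambda>x E. \<Sum>C\<in>U. m E C * x C"
  let ?d = "\<lambda>x. \<Sum>E\<in>F. (b E - ?p x E)\<^sup>2"
  have "closed {x :: 'b \<Rightarrow> real. sum x U = 1}"
    by (intro closed_Collect_eq continuous_intros) simp_all
  then have "compact \<Delta>"
    unfolding \<Delta>_def using compact_unit_functions by (intro compact_Int_closed)
  moreover have vertex: "(\<lambda>C. of_bool (C = B)) \<in> \<Delta>" if "B \<in> U" for B
    using that assms(1) by (simp add: \<Delta>_def of_bool_def)
  then have "\<Delta> \<noteq> {}" using assms(2) by blast
  moreover have "continuous_on \<Delta> ?d"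
    by (intro continuous_intros continuous_on_subset[OF continuous_on_product_coordinates]) auto
  ultimately have "\<exists>x\<in>\<Delta>. \<forall>y\<in>\<Delta>. ?d x \<le> ?d y"
    by (rule continuous_attains_inf)
  then obtain x where x: "x \<in> \<Delta>" and min: "\<And>y. y \<in> \<Delta> \<Longrightarrow> ?d x \<le> ?d y"
    by blast
  have "(\<Sum>E\<in>F. (b E - ?p x E) * (m E B - ?p x E)) \<le> 0" if B: "B \<in> U" for B
  proof (rule ccontr)
    let ?s = "\<Sum>E\<in>F. (b E - ?p x E) * (m E B - ?p x E)"
    let ?q = "\<Sum>E\<in>F. (m E B - ?p x E)\<^sup>2"
    assume "\<not> ?s \<le> 0"
    then have s: "?s > 0" by simp
    \<comment> \<open>Moving from the minimizer a fraction \<open>t\<close> of the way to the vertex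
      \<open>B\<close> changes the squared distance by \<open>t\<^sup>2 * ?q - 2 * t * ?s\<close>,
      which cannot be negative.\<close>
    have ineq: "2 * ?s \<le> t * ?q" if t: "0 < t" "t \<le> 1" for t
    proof -
      let ?y = "\<lambda>C. (1 - t) * x C + t * of_bool (C = B)"
      have "?y \<in> \<Delta>"
        unfolding \<Delta>_def
      proof (intro IntI CollectI allI)
        show "?y C \<in> {0..1}" for C
        proof -
          have "0 \<le> x C" "x C \<le> 1" using x by (auto simp: \<Delta>_def)
          then have "0 \<le> (1 - t) * x C" "(1 - t) * x C \<le> (1 - t) * 1"
            using t by (auto intro: mult_left_mono simp del: mult_1_right)
          then show ?thesis using t by (auto simp: of_bool_def)
        qed
        show "sum ?y U = 1"
          using x vertex[OF B] by (simp add: \<Delta>_def sum.distrib flip: sum_distrib_left)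
      qed
      then have "?d x \<le> ?d ?y" by (rule min)
      moreover have p: "?p ?y E = ?p x E + t * (m E B - ?p x E)" for E
      proof -
        have "?p ?y E = (\<Sum>C\<in>U. (1 - t) * (m E C * x C) + t * (m E C * of_bool (C = B)))"
          by (intro sum.cong) (auto simp: algebra_simps)
        also have "\<dots> = (1 - t) * ?p x E + t * (\<Sum>C\<in>U. m E C * of_bool (C = B))"
          by (simp only: sum.distrib sum_distrib_left)
        also have "(\<Sum>C\<in>U. m E C * of_bool (C = B)) = m E B"
          using B assms(1) by (simp add: of_bool_def if_distrib[of "(*) _"] cong: if_cong)
        finally show ?thesis by (simp add: algebra_simps)
      qed
      have "(b E - ?p ?y E)\<^sup>2 = (b E - ?p x E)\<^sup>2 + (t\<^sup>2 * (m E B - ?p x E)\<^sup>2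
          - (2 * t) * ((b E - ?p x E) * (m E B - ?p x E)))" for E
        unfolding p by (simp add: power2_eq_square algebra_simps)
      then have "?d ?y = ?d x + (t\<^sup>2 * ?q - (2 * t) * ?s)"
        by (simp only: sum.distrib sum_subtractf sum_distrib_left)
      ultimately have "t * (2 * ?s) \<le> t * (t * ?q)"
        by (simp add: power2_eq_square algebra_simps)
      then show ?thesis using mult_le_cancel_left_pos[OF t(1)] by blast
    qed
    have q: "?q \<ge> 0" by (intro sum_nonneg) simp
    \<comment> \<open>Small enough that \<open>t * ?q \<le> ?s\<close>, contradicting
      \<open>2 * ?s \<le> t * ?q\<close>; the summand 1 guards against
      \<open>?q = 0\<close>.\<close>
    define t where "t = min 1 (?s / (1 + ?q))"
    have "0 < t" "t \<le> 1" using s q by (auto simp: t_def)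
    moreover have "t * ?q \<le> ?s / (1 + ?q) * ?q"
      using q by (intro mult_right_mono) (auto simp: t_def)
    moreover have "?s / (1 + ?q) * ?q \<le> ?s"
    proof -
      have "?s * ?q \<le> ?s * (1 + ?q)" using s by (simp add: algebra_simps)
      then show ?thesis using q by (simp add: divide_le_eq)
    qed
    ultimately show False using ineq[of t] s by linarith
  qed
  then show ?thesis using x by (intro that[of x]) (auto simp: \<Delta>_def)
qed

text \<open>The witness \<open>p\<close> is the point of the convex hull nearest to \<open>Bel\<close>.\<close>

lemma incoherent3_separation:
  assumes "\<Omega> \<noteq> {}" "\<F> \<subseteq> Pow \<Omega>" "finite \<F>"
    and no_solution: "\<not> (\<exists>x :: 'a set \<Rightarrow> real.
      (\<forall>E\<in>\<F>. (\<Sum>B\<in>nonempty_events \<Omega> \<F>. min_indicator E B * x B) = Bel E) \<and>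
      (\<Sum>B\<in>nonempty_events \<Omega> \<F>. x B) = 1 \<and> (\<forall>B\<in>nonempty_events \<Omega> \<F>. x B \<ge> 0))"
  shows "\<exists>p\<in>\<F> \<rightarrow> {0..1}. (\<exists>E\<in>\<F>. p E \<noteq> Bel E) \<and>
    (\<forall>B\<in>nonempty_events \<Omega> \<F>. gain \<F> Bel (\<lambda>E. Bel E - p E) B < 0) \<and>
    (\<forall>B\<in>nonempty_events \<Omega> \<F>. quadratic_loss \<F> p B < quadratic_loss \<F> Bel B)"
proof -
  let ?U = "nonempty_events \<Omega> \<F>"
  have "finite ?U" "?U \<noteq> {}"
    using finite_nonempty_events[OF assms(3,2)] space_in_nonempty_events[OF assms(2,1)] by auto
  from convex_hull_nearest_point[OF this, where F = \<F> and b = Bel and m = min_indicator]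
  obtain x where x: "\<And>B. B \<in> ?U \<Longrightarrow> 0 \<le> x B" "sum x ?U = 1"
    "\<And>B. B \<in> ?U \<Longrightarrow> (\<Sum>E\<in>\<F>. (Bel E - (\<Sum>C\<in>?U. min_indicator E C * x C)) *
        (min_indicator E B - (\<Sum>C\<in>?U. min_indicator E C * x C))) \<le> 0"
    by blast
  define p where "p E = (\<Sum>C\<in>?U. min_indicator E C * x C)" for E
  have obtuse: "(\<Sum>E\<in>\<F>. (Bel E - p E) * (min_indicator E B - p E)) \<le> 0" if "B \<in> ?U" for B
    using x(3)[OF that] by (simp add: p_def)
  have "p E \<in> {0..1}" for E
  proof -
    have *: "min_indicator E C * x C = of_bool (C \<subseteq> E) * x C" if "C \<in> ?U" for C
      using that by (simp add: min_indicator_nonempty_events)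
    have "p E \<ge> 0" unfolding p_def using x(1) by (intro sum_nonneg) (simp add: *)
    moreover have "p E \<le> sum x ?U" unfolding p_def using x(1) by (intro sum_mono) (simp add: *)
    ultimately show ?thesis using x(2) by simp
  qed
  then have "p \<in> \<F> \<rightarrow> {0..1}" by simp
  moreover have neq: "\<exists>E\<in>\<F>. p E \<noteq> Bel E"
    using no_solution x unfolding p_def by blast
  let ?D = "\<Sum>E\<in>\<F>. (Bel E - p E)\<^sup>2"
  have D: "?D > 0"
  proof -
    obtain E where "E \<in> \<F>" "p E \<noteq> Bel E" using neq by blast
    then show ?thesis using assms(3) by (intro sum_pos2[of _ E]) auto
  qed
  have "gain \<F> Bel (\<lambda>E. Bel E - p E) B < 0" if "B \<in> ?U" for B
  proof -
    \<comment> \<open>Split \<open>min_indicator E B - Bel E\<close> at \<open>p E\<close>; the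
      stakes paired with \<open>p E - Bel E\<close> contribute \<open>- ?D\<close>.\<close>
    have "gain \<F> Bel (\<lambda>E. Bel E - p E) B
        = (\<Sum>E\<in>\<F>. (Bel E - p E) * (min_indicator E B - p E)) - ?D"
      unfolding gain_def sum_subtractf[symmetric]
      by (intro sum.cong) (auto simp: power2_eq_square algebra_simps)
    then show ?thesis using obtuse[OF that] D by simp
  qed
  moreover have "quadratic_loss \<F> p B < quadratic_loss \<F> Bel B" if "B \<in> ?U" for B
  proof -
    \<comment> \<open>Law of cosines for the triangle formed by \<open>Bel\<close>, \<open>p\<close>
      and the vertex of \<open>B\<close>; the angle at \<open>p\<close> is not acute.\<close>
    have "quadratic_loss \<F> Bel B - quadratic_loss \<F> p B
        = ?D - 2 * (\<Sum>E\<in>\<F>. (Bel E - p E) * (min_indicator E B - p E))"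
      unfolding quadratic_loss_def sum_subtractf[symmetric] sum_distrib_left
      by (intro sum.cong) (auto simp: power2_eq_square algebra_simps)
    then show ?thesis using obtuse[OF that] D by simp
  qed
  ultimately show ?thesis using neq by blast
qed

section \<open>Averages over a solution of the linear system\<close>

text \<open>Averaging with the weights \<open>x\<close> turns \<open>min_indicator E B\<close> into
  \<open>Bel E\<close>, so every bet is fair. A single \<open>x\<close> serves all stakes
  \<open>lam\<close>.\<close>

lemma coherent3_average:
  assumes "coherent3 \<Omega> \<E> Bel" "finite \<F>" "\<F> \<noteq> {}" "\<F> \<subseteq> \<E>"
  obtains x where "\<And>B. B \<in> nonempty_events \<Omega> \<F> \<Longrightarrow> 0 \<le> x B" "sum x (nonempty_events \<Omega> \<F>) = 1"
    "\<And>lam. (\<Sum>B\<in>nonempty_events \<Omega> \<F>. x B * gain \<F> Bel lam B) = 0"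
proof -
  let ?U = "nonempty_events \<Omega> \<F>"
  obtain x where x: "\<And>E. E \<in> \<F> \<Longrightarrow> (\<Sum>B\<in>?U. min_indicator E B * x B) = Bel E"
    "sum x ?U = 1" "\<And>B. B \<in> ?U \<Longrightarrow> x B \<ge> 0"
    using assms unfolding coherent3_def by meson
  have "(\<Sum>B\<in>?U. x B * gain \<F> Bel lam B) = 0" for lam
  proof -
    have "(\<Sum>B\<in>?U. x B * gain \<F> Bel lam B)
        = (\<Sum>E\<in>\<F>. \<Sum>B\<in>?U. x B * (lam E * (min_indicator E B - Bel E)))"
      unfolding gain_def sum_distrib_left by (rule sum.swap)
    also have "\<dots> = (\<Sum>E\<in>\<F>. lam E * ((\<Sum>B\<in>?U. min_indicator E B * x B) - Bel E * sum x ?U))"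
      by (simp add: sum_distrib_left algebra_simps sum_subtractf)
    also have "\<dots> = 0" using x by (intro sum.neutral) simp
    finally show ?thesis .
  qed
  then show ?thesis using x that by blast
qed

text \<open>Weights of total 1 include a positive one, so values that are negative throughout would
  have a negative average.\<close>

lemma exists_nonneg_of_average:
  fixes x g :: "'b \<Rightarrow> real"
  assumes "finite U" "sum x U = 1" "\<And>B. B \<in> U \<Longrightarrow> 0 \<le> x B" "(\<Sum>B\<in>U. x B * g B) \<ge> 0"
  shows "\<exists>B\<in>U. g B \<ge> 0"
proof (rule ccontr)
  assume "\<not> ?thesis"
  then have neg: "g B < 0" if "B \<in> U" for B using that by force
  obtain C where C: "C \<in> U" "x C \<noteq> 0"
    using assms(2) by (metis sum.neutral zero_neq_one)
  have "x C > 0" using C assms(3)[OF C(1)] by simp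
  then have "x C * g C < 0" using neg[OF C(1)] by (rule mult_pos_neg)
  moreover have "x B * g B \<le> 0" if "B \<in> U" for B
    using assms(3) neg that by (simp add: mult_nonneg_nonpos less_imp_le)
  ultimately have "(\<Sum>B\<in>U. x B * g B) < (\<Sum>B\<in>U. 0)"
    using assms(1) C(1) by (intro sum_strict_mono_ex1) auto
  then show False using assms(4) by simp
qed

text \<open>A gain with zero average cannot be negative everywhere; without a solution, the stakes
  \<open>Bel E - p E\<close> given by the projection \<open>p\<close> lose on every event.\<close>

lemma coherent3_iff_coherent4:
  assumes "\<Omega> \<noteq> {}" "\<E> \<subseteq> Pow \<Omega>"
  shows "coherent3 \<Omega> \<E> Bel \<longleftrightarrow> coherent4 \<Omega> \<E> Bel"
proof
  assume c3: "coherent3 \<Omega> \<E> Bel"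
  show "coherent4 \<Omega> \<E> Bel"
    unfolding coherent4_def
  proof (intro allI impI)
    fix \<F> and lam :: "'a set \<Rightarrow> real" assume \<F>: "finite \<F> \<and> \<F> \<noteq> {} \<and> \<F> \<subseteq> \<E>"
    let ?U = "nonempty_events \<Omega> \<F>"
    have fin: "finite ?U" using \<F> assms by (intro finite_nonempty_events) auto
    obtain x where "\<And>B. B \<in> ?U \<Longrightarrow> 0 \<le> x B" "sum x ?U = 1"
      "(\<Sum>B\<in>?U. x B * gain \<F> Bel lam B) = 0"
      using coherent3_average[OF c3] \<F> by metis
    then obtain B where "B \<in> ?U" "gain \<F> Bel lam B \<ge> 0"
      using exists_nonneg_of_average[OF fin, of x "gain \<F> Bel lam"] by auto
    then show "(MAX B\<in>?U. gain \<F> Bel lam B) \<ge> 0"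
      using fin by (subst Max_ge_iff) auto
  qed
next
  assume c4: "coherent4 \<Omega> \<E> Bel"
  show "coherent3 \<Omega> \<E> Bel"
    unfolding coherent3_def
  proof (intro allI impI, rule ccontr)
    fix \<F> assume \<F>: "finite \<F> \<and> \<F> \<noteq> {} \<and> \<F> \<subseteq> \<E>"
    let ?U = "nonempty_events \<Omega> \<F>"
    have Pow: "\<F> \<subseteq> Pow \<Omega>" using \<F> assms by auto
    assume unsolvable: "\<not> (\<exists>x. (\<forall>E\<in>\<F>. (\<Sum>B\<in>?U. min_indicator E B * x B) = Bel E) \<and>
      sum x ?U = 1 \<and> (\<forall>B\<in>?U. x B \<ge> 0))"
    obtain p where p: "p \<in> \<F> \<rightarrow> {0..1}" "\<exists>E\<in>\<F>. p E \<noteq> Bel E"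
      "\<forall>B\<in>?U. gain \<F> Bel (\<lambda>E. Bel E - p E) B < 0"
      "\<forall>B\<in>?U. quadratic_loss \<F> p B < quadratic_loss \<F> Bel B"
      using incoherent3_separation[OF assms(1) Pow conjunct1[OF \<F>] unsolvable] by auto
    have "finite ?U" "?U \<noteq> {}"
      using \<F> finite_nonempty_events[OF _ Pow] space_in_nonempty_events[OF Pow assms(1)] by auto
    with p(3) have "(MAX B\<in>?U. gain \<F> Bel (\<lambda>E. Bel E - p E) B) < 0"
      by (subst Max_less_iff) auto
    then show False using c4 \<F> unfolding coherent4_def by (meson not_less)
  qed
qed

text \<open>A change of assessment alters the loss by a gain plus a sum of squares, and some event
  makes that gain non-negative; without a solution, the projection \<open>p\<close> dominates
  \<open>Bel\<close>.\<close>

lemma coherent3_iff_coherent5: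
  assumes "\<Omega> \<noteq> {}" "\<E> \<subseteq> Pow \<Omega>"
  shows "coherent3 \<Omega> \<E> Bel \<longleftrightarrow> coherent5 \<Omega> \<E> Bel"
proof
  assume c3: "coherent3 \<Omega> \<E> Bel"
  show "coherent5 \<Omega> \<E> Bel"
    unfolding coherent5_def
  proof (intro allI impI notI)
    fix \<F> assume \<F>: "finite \<F> \<and> \<F> \<noteq> {} \<and> \<F> \<subseteq> \<E>"
    let ?U = "nonempty_events \<Omega> \<F>"
    assume "\<exists>Bel'\<in>\<F> \<rightarrow>\<^sub>E {0..1}. Bel' \<noteq> restrict Bel \<F> \<and>
      (\<forall>B\<in>?U. quadratic_loss \<F> Bel' B < quadratic_loss \<F> Bel B)"
    then obtain Bel' where less: "\<forall>B\<in>?U. quadratic_loss \<F> Bel' B < quadratic_loss \<F> Bel B"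
      by blast
    \<comment> \<open>With these stakes the gain is the linear term in the expansion of the loss of
      \<open>Bel'\<close> around \<open>Bel\<close>.\<close>
    let ?g = "\<lambda>B. gain \<F> Bel (\<lambda>E. 2 * (Bel E - Bel' E)) B"
    have fin: "finite ?U" using \<F> assms by (intro finite_nonempty_events) auto
    obtain x where "\<And>B. B \<in> ?U \<Longrightarrow> 0 \<le> x B" "sum x ?U = 1" "(\<Sum>B\<in>?U. x B * ?g B) = 0"
      using coherent3_average[OF c3] \<F> by metis
    then obtain B where B: "B \<in> ?U" "?g B \<ge> 0"
      using exists_nonneg_of_average[OF fin, of x ?g] by auto
    have "quadratic_loss \<F> Bel' B = quadratic_loss \<F> Bel B + ?g B + (\<Sum>E\<in>\<F>. (Bel E - Bel' E)\<^sup>2)"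
      unfolding quadratic_loss_def gain_def sum.distrib[symmetric]
      by (intro sum.cong) (auto simp: power2_eq_square algebra_simps)
    moreover have "(\<Sum>E\<in>\<F>. (Bel E - Bel' E)\<^sup>2) \<ge> 0" by (intro sum_nonneg) simp
    moreover have "quadratic_loss \<F> Bel' B < quadratic_loss \<F> Bel B" using less B by blast
    ultimately show False using B(2) by linarith
  qed
next
  assume c5: "coherent5 \<Omega> \<E> Bel"
  show "coherent3 \<Omega> \<E> Bel"
    unfolding coherent3_def
  proof (intro allI impI, rule ccontr)
    fix \<F> assume \<F>: "finite \<F> \<and> \<F> \<noteq> {} \<and> \<F> \<subseteq> \<E>"
    let ?U = "nonempty_events \<Omega> \<F>"
    have Pow: "\<F> \<subseteq> Pow \<Omega>" using \<F> assms by auto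
    assume unsolvable: "\<not> (\<exists>x. (\<forall>E\<in>\<F>. (\<Sum>B\<in>?U. min_indicator E B * x B) = Bel E) \<and>
      sum x ?U = 1 \<and> (\<forall>B\<in>?U. x B \<ge> 0))"
    obtain p where p: "p \<in> \<F> \<rightarrow> {0..1}" "\<exists>E\<in>\<F>. p E \<noteq> Bel E"
      "\<forall>B\<in>?U. gain \<F> Bel (\<lambda>E. Bel E - p E) B < 0"
      "\<forall>B\<in>?U. quadratic_loss \<F> p B < quadratic_loss \<F> Bel B"
      using incoherent3_separation[OF assms(1) Pow conjunct1[OF \<F>] unsolvable] by auto
    \<comment> \<open>Competitors in coherent-5 are extensional on \<open>\<F>\<close>; losses and
      the disagreement with \<open>Bel\<close> only involve values there.\<close>
    have "restrict p \<F> \<in> \<F> \<rightarrow>\<^sub>E {0..1}" using p(1) by auto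
    moreover have "restrict p \<F> \<noteq> restrict Bel \<F>" using p(2) by (metis restrict_apply')
    moreover have "quadratic_loss \<F> (restrict p \<F>) B < quadratic_loss \<F> Bel B" if "B \<in> ?U" for B
      using p(4) that by (simp add: quadratic_loss_def)
    ultimately have "\<exists>Bel'\<in>\<F> \<rightarrow>\<^sub>E {0..1}. Bel' \<noteq> restrict Bel \<F> \<and>
      (\<forall>B\<in>?U. quadratic_loss \<F> Bel' B < quadratic_loss \<F> Bel B)"
      by (intro bexI[of _ "restrict p \<F>"]) auto
    then show False
      using c5[unfolded coherent5_def, THEN spec, THEN mp, OF \<F>] by (rule notE[rotated])
  qed
qed

theorem theorem1:
  fixes \<Omega> :: "'a set" and \<E> :: "'a set set" and Bel :: "'a set \<Rightarrow> real"
  assumes "\<Omega> \<noteq> {}"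
    and "\<E> \<noteq> {}" and "\<E> \<subseteq> Pow \<Omega>"
    and "Bel \<in> \<E> \<rightarrow> {0..1}"
  shows "(coherent1 \<Omega> \<E> Bel \<longleftrightarrow> coherent2 \<Omega> \<E> Bel) \<and>
         (coherent2 \<Omega> \<E> Bel \<longleftrightarrow> coherent3 \<Omega> \<E> Bel) \<and>
         (coherent3 \<Omega> \<E> Bel \<longleftrightarrow> coherent4 \<Omega> \<E> Bel) \<and>
         (coherent4 \<Omega> \<E> Bel \<longleftrightarrow> coherent5 \<Omega> \<E> Bel)"
proof -
  \<comment> \<open>The first three conditions form the cycle 1, 3, 2, 1; conditions 4 and 5 are
    attached to 3.\<close>
  have "coherent1 \<Omega> \<E> Bel \<Longrightarrow> coherent3 \<Omega> \<E> Bel"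
    by (rule coherent1_imp_coherent3[OF assms(3)])
  moreover have "coherent3 \<Omega> \<E> Bel \<Longrightarrow> coherent2 \<Omega> \<E> Bel"
    by (rule coherent3_imp_coherent2[OF assms(3,2)])
  moreover have "coherent2 \<Omega> \<E> Bel \<Longrightarrow> coherent1 \<Omega> \<E> Bel"
    by (rule coherent2_imp_coherent1[OF assms(3)])
  moreover have "coherent3 \<Omega> \<E> Bel \<longleftrightarrow> coherent4 \<Omega> \<E> Bel"
    by (rule coherent3_iff_coherent4[OF assms(1,3)])
  moreover have "coherent3 \<Omega> \<E> Bel \<longleftrightarrow> coherent5 \<Omega> \<E> Bel"
    by (rule coherent3_iff_coherent5[OF assms(1,3)])
  ultimately show ?thesis by argo
qed

end
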